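(* Let $(X,\mathcal B)$ be an uncountable standard Borel space, and let $Ctbl(X)$ be the normal subgroup of $Aut(X,\mathcal B)$ consisting of all automorphisms $T$ for which the set $\{x\in X: Tx\neq x\}$ is at most countable. Then $Ctbl(X)$ is closed in $Aut(X,\mathcal B)$ with respect to each of the topologies $\tau,\tau',\tau'',p,\tilde p,\overline p,\tau_0,p_0$ defined in the context.
   Context: $Aut(X,\mathcal B)$ is the group of all one-to-one Borel automorphisms of $X$. $\mathcal M_1(X)$ is the set of Borel probability measures on $X$, $\mathcal M_1^c(X)$ the subset of continuous (non-atomic) ones, $\mathcal B_0\subset\mathcal B$ the family of uncountable Borel sets. $B(X)$ is the space of bounded real-valued Borel functions with the sup norm $\|\cdot\|$, and $B(X)_1=\{f\in B(X):\|f\|\le 1\}$. For $S,T\in Aut(X,\mathcal B)$, $E(S,T)=\{x: Tx\ne Sx\}\cup\{x: T^{-1}x\ne S^{-1}x\}$, and $\mu\circ S(f)=\int_X f(S^{-1}x)\,d\mu(x)$. The topologies are given by the following bases of neighborhoods, where $T\in Aut(X,\mathcal B)$, $\mu_j\in\mathcal M_1(X)$, $F_i\in\mathcal B$, $f_i\in B(X)$, $\varepsilon>0$ (all families finite): $\tau$: $U(T;\mu_1,\dots,\mu_n;\varepsilon)=\{S:\mu_j(E(S,T))<\varepsilon,\ j=1,\dots,n\}$; $\tau'$: $\{S:\sup_{F\in\mathcal B}\mu_j(TF\,\Delta\, SF)<\varepsilon,\ j=1,\dots,n\}$; $\tau''$: $\{S:\sup_{f\in B(X)_1}|\mu_j\circ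 S(f)-\mu_j\circ T(f)|<\varepsilon,\ j=1,\dots,n\}$; $p$: $W(T;F_1,\dots,F_k)=\{S: SF_i=TF_i,\ i=1,\dots,k\}$; $\tilde p$: $\{S:\|f_i\circ T^{-1}-f_i\circ S^{-1}\|<\varepsilon,\ i=1,\dots,m\}$; $\overline p$: $\{S:\mu_j(SF_i\,\Delta\, TF_i)+\mu_j(S^{-1}F_i\,\Delta\, T^{-1}F_i)<\varepsilon\ \text{for all } i\le k, j\le n\}$; $\tau_0$: the sets $U(T;\mu_1,\dots,\mu_n;\varepsilon)$ with all $\mu_j\in\mathcal M_1^c(X)$ only; $p_0$: the sets $W(T;F_1,\dots,F_k)$ with all $F_i\in\mathcal B_0$ only. *)

theory Defs
  imports "HOL-Probability.Probability" "HOL-Combinatorics.Permutations"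
begin

text \<open>
  A Borel space is given by the carrier and the sigma-algebra of a value of type
  \<^typ>\<open>'a measure\<close>; the measure that comes with it is irrelevant.
\<close>

definition standard_borel :: "'a measure \<Rightarrow> bool" where
  "standard_borel X \<longleftrightarrow>
     (\<exists>\<O>. completely_metrizable_space \<O> \<and> separable_space \<O> \<and> topspace \<O> = space X \<and>
          sets X = sigma_sets (space X) {U. openin \<O> U})"

text \<open>
  Automorphisms are extended by the identity outside the carrier. This makes them
  genuine permutations of the whole type, so that equality of automorphisms is equality of
  functions, the group operation is composition, and the inverse is \<^term>\<open>inv T\<close>.
\<close>

definition Aut :: "'a measure \<Rightarrow> ('a \<Rightarrow> 'a) set" where
  "Aut X = {T. T permutes space X \<and> T \<in> measurable X X \<and> inv T \<in> measurable X X}"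

definition Ctbl :: "'a measure \<Rightarrow> ('a \<Rightarrow> 'a) set" where
  "Ctbl X = {T \<in> Aut X. countable {x \<in> space X. T x \<noteq> x}}"

definition prob_measures :: "'a measure \<Rightarrow> 'a measure set" where
  "prob_measures X = {\<mu>. prob_space \<mu> \<and> sets \<mu> = sets X}"

definition cont_prob_measures :: "'a measure \<Rightarrow> 'a measure set" where
  "cont_prob_measures X = {\<mu> \<in> prob_measures X. \<forall>x\<in>space X. measure \<mu> {x} = 0}"

definition uncountable_sets :: "'a measure \<Rightarrow> 'a set set" where
  "uncountable_sets X = {F \<in> sets X. uncountable F}"

definition sup_norm :: "'a measure \<Rightarrow> ('a \<Rightarrow> real) \<Rightarrow> real" where
  "sup_norm X f = (SUP x\<in>space X. \<bar>f x\<bar>)"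

definition bounded_borel :: "'a measure \<Rightarrow> ('a \<Rightarrow> real) set" where
  "bounded_borel X = {f \<in> borel_measurable X. bounded (f ` space X)}"

definition bounded_borel_unit :: "'a measure \<Rightarrow> ('a \<Rightarrow> real) set" where
  "bounded_borel_unit X = {f \<in> bounded_borel X. sup_norm X f \<le> 1}"

definition diff_set :: "'a measure \<Rightarrow> ('a \<Rightarrow> 'a) \<Rightarrow> ('a \<Rightarrow> 'a) \<Rightarrow> 'a set" where
  "diff_set X S T = {x \<in> space X. T x \<noteq> S x} \<union> {x \<in> space X. inv T x \<noteq> inv S x}"

definition comp_integral :: "'a measure \<Rightarrow> ('a \<Rightarrow> 'a) \<Rightarrow> ('a \<Rightarrow> real) \<Rightarrow> real" where
  "comp_integral \<mu> S f = (\<integral>x. f (inv S x) \<partial>\<mu>)"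

text \<open>
  Basic neighbourhoods of \<^term>\<open>T\<close>. The finite families are finite sets
  \<open>\<M>\<close> (measures), \<open>\<F>\<close> (Borel sets) and \<open>\<B>\<close> (functions); an empty family only
  contributes the whole group.
\<close>

definition nbhd_tau ::
    "'a measure \<Rightarrow> ('a \<Rightarrow> 'a) \<Rightarrow> 'a measure set \<Rightarrow> real \<Rightarrow> ('a \<Rightarrow> 'a) set" where
  "nbhd_tau X T \<M> \<epsilon> = {S \<in> Aut X. \<forall>\<mu>\<in>\<M>. measure \<mu> (diff_set X S T) < \<epsilon>}"

definition nbhd_tau' ::
    "'a measure \<Rightarrow> ('a \<Rightarrow> 'a) \<Rightarrow> 'a measure set \<Rightarrow> real \<Rightarrow> ('a \<Rightarrow> 'a) set" where
  "nbhd_tau' X T \<M> \<epsilon> =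
     {S \<in> Aut X. \<forall>\<mu>\<in>\<M>. (SUP F\<in>sets X. measure \<mu> (sym_diff (T ` F) (S ` F))) < \<epsilon>}"

definition nbhd_tau'' ::
    "'a measure \<Rightarrow> ('a \<Rightarrow> 'a) \<Rightarrow> 'a measure set \<Rightarrow> real \<Rightarrow> ('a \<Rightarrow> 'a) set" where
  "nbhd_tau'' X T \<M> \<epsilon> =
     {S \<in> Aut X. \<forall>\<mu>\<in>\<M>.
        (SUP f\<in>bounded_borel_unit X. \<bar>comp_integral \<mu> S f - comp_integral \<mu> T f\<bar>) < \<epsilon>}"

definition nbhd_p ::
    "'a measure \<Rightarrow> ('a \<Rightarrow> 'a) \<Rightarrow> 'a set set \<Rightarrow> ('a \<Rightarrow> 'a) set" where
  "nbhd_p X T \<F> = {S \<in> Aut X. \<forall>F\<in>\<F>. S ` F = T ` F}"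

definition nbhd_p_tilde ::
    "'a measure \<Rightarrow> ('a \<Rightarrow> 'a) \<Rightarrow> ('a \<Rightarrow> real) set \<Rightarrow> real \<Rightarrow> ('a \<Rightarrow> 'a) set" where
  "nbhd_p_tilde X T \<B> \<epsilon> =
     {S \<in> Aut X. \<forall>f\<in>\<B>. sup_norm X (\<lambda>x. f (inv T x) - f (inv S x)) < \<epsilon>}"

definition nbhd_p_bar ::
    "'a measure \<Rightarrow> ('a \<Rightarrow> 'a) \<Rightarrow> 'a set set \<Rightarrow> 'a measure set \<Rightarrow> real \<Rightarrow> ('a \<Rightarrow> 'a) set" where
  "nbhd_p_bar X T \<F> \<M> \<epsilon> =
     {S \<in> Aut X. \<forall>F\<in>\<F>. \<forall>\<mu>\<in>\<M>.
        measure \<mu> (sym_diff (S ` F) (T ` F))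
          + measure \<mu> (sym_diff (inv S ` F) (inv T ` F)) < \<epsilon>}"

text \<open>
  Each of the following families is a base of a topology: by the triangle inequality,
  a basic neighbourhood of \<^term>\<open>T\<close> contains a basic neighbourhood of each of its points, and
  the intersection of two basic neighbourhoods of \<^term>\<open>T\<close> contains a third one (take the
  union of the families and the minimum of the radii). Hence the generated topology is the
  one that has the given sets as bases of neighbourhoods.
\<close>

definition top_tau :: "'a measure \<Rightarrow> ('a \<Rightarrow> 'a) topology" where
  "top_tau X = topology_generated_by
     {nbhd_tau X T \<M> \<epsilon> | T \<M> \<epsilon>. T \<in> Aut X \<and> finite \<M> \<and> \<M> \<subseteq> prob_measures X \<and> \<epsilon> > 0}"

definition top_tau' :: "'a measure \<Rightarrow> ('a \<Rightarrow> 'a) topology" where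
  "top_tau' X = topology_generated_by
     {nbhd_tau' X T \<M> \<epsilon> | T \<M> \<epsilon>. T \<in> Aut X \<and> finite \<M> \<and> \<M> \<subseteq> prob_measures X \<and> \<epsilon> > 0}"

definition top_tau'' :: "'a measure \<Rightarrow> ('a \<Rightarrow> 'a) topology" where
  "top_tau'' X = topology_generated_by
     {nbhd_tau'' X T \<M> \<epsilon> | T \<M> \<epsilon>. T \<in> Aut X \<and> finite \<M> \<and> \<M> \<subseteq> prob_measures X \<and> \<epsilon> > 0}"

definition top_p :: "'a measure \<Rightarrow> ('a \<Rightarrow> 'a) topology" where
  "top_p X = topology_generated_by
     {nbhd_p X T \<F> | T \<F>. T \<in> Aut X \<and> finite \<F> \<and> \<F> \<subseteq> sets X}"

definition top_p_tilde :: "'a measure \<Rightarrow> ('a \<Rightarrow> 'a) topology" where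
  "top_p_tilde X = topology_generated_by
     {nbhd_p_tilde X T \<B> \<epsilon> | T \<B> \<epsilon>. T \<in> Aut X \<and> finite \<B> \<and> \<B> \<subseteq> bounded_borel X \<and> \<epsilon> > 0}"

definition top_p_bar :: "'a measure \<Rightarrow> ('a \<Rightarrow> 'a) topology" where
  "top_p_bar X = topology_generated_by
     {nbhd_p_bar X T \<F> \<M> \<epsilon> | T \<F> \<M> \<epsilon>. T \<in> Aut X \<and> finite \<F> \<and> \<F> \<subseteq> sets X \<and>
        finite \<M> \<and> \<M> \<subseteq> prob_measures X \<and> \<epsilon> > 0}"

definition top_tau_0 :: "'a measure \<Rightarrow> ('a \<Rightarrow> 'a) topology" where
  "top_tau_0 X = topology_generated_by
     {nbhd_tau X T \<M> \<epsilon> | T \<M> \<epsilon>. T \<in> Aut X \<and> finite \<M> \<and> \<M> \<subseteq> cont_prob_measures X \<and> \<epsilon> > 0}"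

definition top_p_0 :: "'a measure \<Rightarrow> ('a \<Rightarrow> 'a) topology" where
  "top_p_0 X = topology_generated_by
     {nbhd_p X T \<F> | T \<F>. T \<in> Aut X \<and> finite \<F> \<and> \<F> \<subseteq> uncountable_sets X}"

text \<open>\<^term>\<open>Aut X\<close> is a group under composition and \<^term>\<open>Ctbl X\<close> is a normal subgroup.\<close>

lemma Aut_id: "id \<in> Aut X"
  by (simp add: Aut_def permutes_id measurable_ident inv_id)

lemma Aut_comp:
  assumes "S \<in> Aut X" "T \<in> Aut X"
  shows "S \<circ> T \<in> Aut X"
proof -
  have "inv (S \<circ> T) = inv T \<circ> inv S"
    using assms by (intro o_inv_distrib) (auto simp: Aut_def intro: permutes_bij)
  then show ?thesis
    using assms unfolding Aut_def
    by (simp add: permutes_compose measurable_comp[of T X X S X]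
        measurable_comp[of "inv S" X X "inv T" X])
qed

lemma Aut_inv: "T \<in> Aut X \<Longrightarrow> inv T \<in> Aut X"
  by (auto simp: Aut_def permutes_inv permutes_inv_inv)

lemma Ctbl_id: "id \<in> Ctbl X"
  by (simp add: Ctbl_def Aut_id)

lemma Ctbl_comp:
  assumes "S \<in> Ctbl X" "T \<in> Ctbl X"
  shows "S \<circ> T \<in> Ctbl X"
proof -
  have "{x \<in> space X. (S \<circ> T) x \<noteq> x} \<subseteq> {x \<in> space X. S x \<noteq> x} \<union> {x \<in> space X. T x \<noteq> x}"
    by auto
  with assms show ?thesis
    unfolding Ctbl_def by (simp add: Aut_comp countable_subset[OF _ countable_Un])
qed

lemma Ctbl_inv:
  assumes "T \<in> Ctbl X"
  shows "inv T \<in> Ctbl X"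
proof -
  have "T permutes space X"
    using assms by (simp add: Ctbl_def Aut_def)
  then have "{x \<in> space X. inv T x \<noteq> x} = {x \<in> space X. T x \<noteq> x}"
    by (metis permutes_inv_eq)
  with assms show ?thesis
    by (simp add: Ctbl_def Aut_inv)
qed

lemma Ctbl_normal:
  assumes T: "T \<in> Ctbl X" and S: "S \<in> Aut X"
  shows "S \<circ> T \<circ> inv S \<in> Ctbl X"
proof -
  have perm: "S permutes space X"
    using S by (simp add: Aut_def)
  have "{x \<in> space X. (S \<circ> T \<circ> inv S) x \<noteq> x} \<subseteq> S ` {x \<in> space X. T x \<noteq> x}"
  proof
    fix x assume x: "x \<in> {x \<in> space X. (S \<circ> T \<circ> inv S) x \<noteq> x}"
    have "x = S (inv S x)"
      using perm by (simp add: permutes_inverses)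
    moreover have "inv S x \<in> space X"
      using x permutes_in_image[OF permutes_inv[OF perm]] by auto
    moreover have "T (inv S x) \<noteq> inv S x"
      using x perm by (auto simp: permutes_inverses)
    ultimately show "x \<in> S ` {x \<in> space X. T x \<noteq> x}"
      by blast
  qed
  moreover have "S \<circ> T \<circ> inv S \<in> Aut X"
    using assms by (simp add: Ctbl_def Aut_comp Aut_inv)
  ultimately show ?thesis
    using T unfolding Ctbl_def by (simp add: countable_subset[OF _ countable_image])
qed

end

(*
  If T moves uncountably many points, then, as countably many Borel sets separate points, some
  uncountable Borel set F is disjoint from T F. An S moving only countably many points fixes almost
  all of F, so S F differs from T F; this settles p, its variant for bounded functions, and p_0.
  For the other topologies one needs a continuous probability measure mu with mu(F) = 1: since
  mu does not see countable sets, the distance between S and T measured by mu is then at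
  least 1, with F or its indicator function as test object.

  The measure comes from the perfect set theorem. Borel sets are images of closed sets of integer
  sequences under continuous maps, an uncountable such image contains an injective continuous image
  of the space of 0-1 sequences, and the distribution of fair coin tosses is pushed forward to it.
*)

theory Submission
  imports Defs
begin

subsection \<open>Analytic sets\<close>

text \<open>
  Sequence spaces carry the product of discrete topologies, expressed by agreement of initial segments.
\<close>

definition agree :: "nat \<Rightarrow> (nat \<Rightarrow> 'b) \<Rightarrow> (nat \<Rightarrow> 'b) \<Rightarrow> bool" where
  "agree n x y \<longleftrightarrow> (\<forall>i<n. x i = y i)"

definition seq_closed :: "(nat \<Rightarrow> 'b) set \<Rightarrow> bool" where
  "seq_closed C \<longleftrightarrow> (\<forall>x. (\<forall>n. \<exists>y\<in>C. agree n x y) \<longrightarrow> x \<in> C)"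

definition seq_continuous :: "'a topology \<Rightarrow> (nat \<Rightarrow> 'b) set \<Rightarrow> ((nat \<Rightarrow> 'b) \<Rightarrow> 'a) \<Rightarrow> bool" where
  "seq_continuous \<O> C f \<longleftrightarrow>
     (\<forall>x\<in>C. \<forall>U. openin \<O> U \<longrightarrow> f x \<in> U \<longrightarrow> (\<exists>n. \<forall>y\<in>C. agree n x y \<longrightarrow> f y \<in> U))"

text \<open>Analytic sets in the classical sense. Taking an arbitrary closed subset of Baire space
  as the source covers the empty set and lets unions and intersections cut out their source
  freely.\<close>

definition analytic_in :: "'a topology \<Rightarrow> 'a set \<Rightarrow> bool" where
  "analytic_in \<O> A \<longleftrightarrow> A \<subseteq> topspace \<O> \<and>
     (\<exists>(C :: (nat \<Rightarrow> nat) set) f. seq_closed C \<and> seq_continuous \<O> C f \<and> f ` C = A)"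

section \<open>Agreement of initial segments\<close>

lemma agree_refl [simp]: "agree n x x"
  by (simp add: agree_def)

lemma agree_sym: "agree n x y \<longleftrightarrow> agree n y x"
  by (auto simp: agree_def)

lemma agree_trans: "agree n x y \<Longrightarrow> agree n y z \<Longrightarrow> agree n x z"
  by (simp add: agree_def)

lemma agree_mono: "agree n x y \<Longrightarrow> m \<le> n \<Longrightarrow> agree m x y"
  by (simp add: agree_def)

text \<open>Only the finitely many entries \<open>g i\<close> with \<open>i < n\<close> are read.
  Countable intersections use this as continuity of the projections of a split sequence.\<close>

lemma agree_reindex: "\<exists>m. \<forall>x y. agree m x y \<longrightarrow> agree n (\<lambda>i. x (g i)) (\<lambda>i. y (g i))"
proof (intro exI allI impI)
  fix x y :: "nat \<Rightarrow> 'b" assume "agree (Suc (Max (g ` {..n}))) x y"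
  then show "agree n (\<lambda>i. x (g i)) (\<lambda>i. y (g i))"
    by (simp add: agree_def less_Suc_eq_le)
qed

lemma seq_closedD: "seq_closed C \<Longrightarrow> (\<And>n. \<exists>y\<in>C. agree n x y) \<Longrightarrow> x \<in> C"
  by (auto simp: seq_closed_def)

lemma seq_continuousD:
  assumes "seq_continuous \<O> C f" "x \<in> C" "openin \<O> U" "f x \<in> U"
  shows "\<exists>n. \<forall>y\<in>C. agree n x y \<longrightarrow> f y \<in> U"
  using assms by (simp add: seq_continuous_def)

text \<open>The first entry of a sequence selects \<open>n\<close> and the remaining entries are an
  argument for \<open>f n\<close>: the source \<open>D\<close> is the disjoint sum of the sets
  \<open>C n\<close>.\<close>

lemma analytic_in_Union:
  fixes A :: "nat \<Rightarrow> 'a set"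
  assumes "\<And>n. analytic_in \<O> (A n)"
  shows "analytic_in \<O> (\<Union>n. A n)"
proof -
  obtain C :: "nat \<Rightarrow> (nat \<Rightarrow> nat) set" and f
    where C: "\<And>n. seq_closed (C n)" and f: "\<And>n. seq_continuous \<O> (C n) (f n)"
      and fC: "\<And>n. f n ` C n = A n"
    using assms unfolding analytic_in_def by metis
  define D where "D = {x. (\<lambda>i. x (Suc i)) \<in> C (x 0)}"
  define g where "g x = f (x 0) (\<lambda>i. x (Suc i))" for x :: "nat \<Rightarrow> nat"
  \<comment> \<open>Agreement on \<open>Suc n\<close> entries fixes the selector, so both tails are
    tested against the same set and the same map.\<close>
  have tail: "agree n (\<lambda>i. x (Suc i)) (\<lambda>i. y (Suc i)) \<and> x 0 = y 0"
    if "agree (Suc n) x y" for n and x y :: "nat \<Rightarrow> nat"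
    using that by (simp add: agree_def)
  have "seq_closed D"
    unfolding seq_closed_def
  proof (intro allI impI)
    fix x :: "nat \<Rightarrow> nat" assume x: "\<forall>n. \<exists>y\<in>D. agree n x y"
    have "(\<lambda>i. x (Suc i)) \<in> C (x 0)"
    proof (rule seq_closedD[OF C])
      fix n
      obtain y where y: "y \<in> D" "agree (Suc n) x y" using x by blast
      show "\<exists>z\<in>C (x 0). agree n (\<lambda>i. x (Suc i)) z"
      proof
        show "agree n (\<lambda>i. x (Suc i)) (\<lambda>i. y (Suc i))" using tail[OF y(2)] by simp
        show "(\<lambda>i. y (Suc i)) \<in> C (x 0)" using y(1) tail[OF y(2)] by (simp add: D_def)
      qed
    qed
    then show "x \<in> D" by (simp add: D_def)
  qed
  moreover have "seq_continuous \<O> D g"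
    unfolding seq_continuous_def
  proof (intro ballI allI impI)
    fix x U assume x: "x \<in> D" and U: "openin \<O> U" "g x \<in> U"
    obtain n where n: "\<forall>y\<in>C (x 0). agree n (\<lambda>i. x (Suc i)) y \<longrightarrow> f (x 0) y \<in> U"
      using seq_continuousD[of \<O> "C (x 0)" "f (x 0)" "\<lambda>i. x (Suc i)" U] f x U
      by (auto simp: D_def g_def)
    have "g y \<in> U" if "y \<in> D" "agree (Suc n) x y" for y
      using that(1) tail[OF that(2)] n[rule_format, of "\<lambda>i. y (Suc i)"] by (simp add: D_def g_def)
    then show "\<exists>n. \<forall>y\<in>D. agree n x y \<longrightarrow> g y \<in> U" by blast
  qed
  moreover have "g ` D = (\<Union>n. A n)"
  proof
    show "g ` D \<subseteq> (\<Union>n. A n)"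
      using fC by (auto simp: D_def g_def)
    show "(\<Union>n. A n) \<subseteq> g ` D"
    proof
      fix a assume "a \<in> (\<Union>n. A n)"
      then obtain n x where "x \<in> C n" "a = f n x" using fC by blast
      then show "a \<in> g ` D"
        by (intro image_eqI[of _ _ "case_nat n x"]) (auto simp: D_def g_def)
    qed
  qed
  ultimately show ?thesis
    using assms unfolding analytic_in_def by blast
qed

text \<open>The pairing function splits one sequence into countably many. The source
  \<open>D\<close> is the fibre product: the n-th part lies in \<open>C n\<close>, and all parts
  have the same image.\<close>

lemma analytic_in_Inter:
  fixes A :: "nat \<Rightarrow> 'a set"
  assumes \<O>: "Hausdorff_space \<O>" and "\<And>n. analytic_in \<O> (A n)"
  shows "analytic_in \<O> (\<Inter>n. A n)"
proof -
  obtain C :: "nat \<Rightarrow> (nat \<Rightarrow> nat) set" and f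
    where C: "\<And>n. seq_closed (C n)" and f: "\<And>n. seq_continuous \<O> (C n) (f n)"
      and fC: "\<And>n. f n ` C n = A n" and A: "\<And>n. A n \<subseteq> topspace \<O>"
    using assms(2) unfolding analytic_in_def by metis
  define s where "s n x = (\<lambda>i. x (prod_encode (n, i)))" for n and x :: "nat \<Rightarrow> nat"
  define D where "D = {x. \<forall>n. s n x \<in> C n \<and> f n (s n x) = f 0 (s 0 x)}"
  define g where "g x = f 0 (s 0 x)" for x
  have s: "\<exists>m. \<forall>x y. agree m x y \<longrightarrow> agree k (s n x) (s n y)" for k n
    unfolding s_def by (rule agree_reindex)
  have "seq_closed D"
    unfolding seq_closed_def
  proof (intro allI impI)
    fix x :: "nat \<Rightarrow> nat" assume x: "\<forall>n. \<exists>y\<in>D. agree n x y"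
    have sC: "s n x \<in> C n" for n
    proof (rule seq_closedD[OF C])
      fix k
      obtain m where m: "\<forall>x y. agree m x y \<longrightarrow> agree k (s n x) (s n y)" using s by blast
      obtain y where y: "y \<in> D" "agree m x y" using x by blast
      show "\<exists>z\<in>C n. agree k (s n x) z"
      proof
        show "agree k (s n x) (s n y)" using m y(2) by simp
        show "s n y \<in> C n" using y(1) by (simp add: D_def)
      qed
    qed
    moreover have "f n (s n x) = f 0 (s 0 x)" for n
    \<comment> \<open>Coincidence is a closed condition by the Hausdorff property: disjoint
      neighbourhoods of the two values would also contain the two corresponding values at some
      \<open>y\<close> in \<open>D\<close> that agrees long enough with \<open>x\<close>, and these
      are equal.\<close>
    proof (rule ccontr)
      assume ne: "f n (s n x) \<noteq> f 0 (s 0 x)"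
      have "f n (s n x) \<in> topspace \<O>" "f 0 (s 0 x) \<in> topspace \<O>"
        using sC fC A by blast+
      then obtain U V where U: "openin \<O> U" "f n (s n x) \<in> U"
        and V: "openin \<O> V" "f 0 (s 0 x) \<in> V" and UV: "disjnt U V"
        using \<O> ne unfolding Hausdorff_space_def by metis
      obtain k where k: "\<forall>y\<in>C n. agree k (s n x) y \<longrightarrow> f n y \<in> U"
        using seq_continuousD[of \<O> "C n" "f n" "s n x" U] f sC U by auto
      obtain l where l: "\<forall>y\<in>C 0. agree l (s 0 x) y \<longrightarrow> f 0 y \<in> V"
        using seq_continuousD[of \<O> "C 0" "f 0" "s 0 x" V] f sC V by auto
      obtain m where m: "\<forall>x y. agree m x y \<longrightarrow> agree k (s n x) (s n y)" using s by blast
      obtain m' where m': "\<forall>x y. agree m' x y \<longrightarrow> agree l (s 0 x) (s 0 y)" using s by blast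
      obtain y where y: "y \<in> D" "agree (max m m') x y" using x by blast
      then have "agree m x y" "agree m' x y" by (auto intro: agree_mono)
      then have "f n (s n y) \<in> U" "f 0 (s 0 y) \<in> V"
        using y(1) k l m m' by (auto simp: D_def)
      moreover have "f n (s n y) = f 0 (s 0 y)"
        using y(1) unfolding D_def by blast
      ultimately show False
        using UV by (simp add: disjnt_iff)
    qed
    ultimately show "x \<in> D" by (simp add: D_def)
  qed
  moreover have "seq_continuous \<O> D g"
    unfolding seq_continuous_def
  proof (intro ballI allI impI)
    fix x U assume x: "x \<in> D" and U: "openin \<O> U" "g x \<in> U"
    obtain l where l: "\<forall>y\<in>C 0. agree l (s 0 x) y \<longrightarrow> f 0 y \<in> U"
      using seq_continuousD[of \<O> "C 0" "f 0" "s 0 x" U] f x U by (auto simp: D_def g_def)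
    obtain m where m: "\<forall>x y. agree m x y \<longrightarrow> agree l (s 0 x) (s 0 y)" using s by blast
    have "\<forall>y\<in>D. agree m x y \<longrightarrow> g y \<in> U"
      using l m by (auto simp: D_def g_def)
    then show "\<exists>n. \<forall>y\<in>D. agree n x y \<longrightarrow> g y \<in> U" ..
  qed
  moreover have "g ` D = (\<Inter>n. A n)"
  proof
    show "g ` D \<subseteq> (\<Inter>n. A n)"
    proof safe
      fix x n assume "x \<in> D"
      then have D: "\<forall>n. s n x \<in> C n \<and> f n (s n x) = g x" by (simp add: D_def g_def)
      then have "f n (s n x) \<in> A n" unfolding fC[of n, symmetric] by (intro imageI) simp
      then show "g x \<in> A n" using D by simp
    qed
    show "(\<Inter>n. A n) \<subseteq> g ` D"
    proof
      fix a assume "a \<in> (\<Inter>n. A n)"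
      then have a: "a \<in> f n ` C n" for n by (simp add: fC)
      have "\<exists>x. x \<in> C n \<and> f n x = a" for n using a[of n] by (auto simp: image_iff)
      then obtain x where x: "\<And>n. x n \<in> C n" "\<And>n. f n (x n) = a" by metis
      \<comment> \<open>Interleaving the chosen preimages inverts the splitting.\<close>
      define z where "z i = (case prod_decode i of (n, j) \<Rightarrow> x n j)" for i
      have "s n z = x n" for n
        by (simp add: s_def z_def)
      then show "a \<in> g ` D"
        using x by (intro image_eqI[of _ _ z]) (auto simp: D_def g_def)
    qed
  qed
  moreover have "(\<Inter>n. A n) \<subseteq> topspace \<O>" using A by blast
  ultimately show ?thesis
    unfolding analytic_in_def by (intro conjI exI)
qed

text \<open>A sequence of indices codes the point that it approximates at a geometric rate.\<close>

lemma analytic_in_closedin: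
  assumes \<O>: "completely_metrizable_space \<O>" "separable_space \<O>" and K: "closedin \<O> K"
  shows "analytic_in \<O> K"
proof (cases "K = {}")
  case True
  have "seq_closed ({} :: (nat \<Rightarrow> nat) set)" "seq_continuous \<O> ({} :: (nat \<Rightarrow> nat) set) f" for f
    by (auto simp: seq_closed_def seq_continuous_def)
  then show ?thesis
    using True unfolding analytic_in_def by blast
next
  case False
  obtain M d where "Metric_space M d" and compl: "Metric_space.mcomplete M d"
    and \<O>_def: "\<O> = Metric_space.mtopology M d"
    using \<O>(1) unfolding completely_metrizable_space_def by blast
  then interpret Metric_space M d by simp
  have KM: "K \<subseteq> M" using closedin_subset[OF K] by (simp add: \<O>_def)
  obtain Q where Q: "countable Q" "Q \<subseteq> M" "mtopology closure_of Q = M"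
    using \<O>(2) unfolding separable_space_def \<O>_def by auto
  have dense: "\<exists>q\<in>Q. d a q < r" if "a \<in> M" "r > 0" for a r
    using that Q(3) unfolding metric_closure_of by (auto simp: mball_def set_eq_iff)
  have "Q \<noteq> {}" using False KM dense zero_less_one by blast
  then obtain e :: "nat \<Rightarrow> 'a" where e: "range e = Q"
    using Q(1) uncountable_def by blast
  have eM [simp]: "e i \<in> M" for i using e Q(2) by blast
  \<comment> \<open>The bound is not strict, so that it survives the passage to a limit when
    \<open>C\<close> is shown to be closed.\<close>
  define R where "R x a \<longleftrightarrow> a \<in> K \<and> (\<forall>i. d (e (x i)) a \<le> (1/2)^i)" for x :: "nat \<Rightarrow> nat" and a
  define C where "C = {x. \<exists>a. R x a}"
  define f where "f x = (SOME a. R x a)" for x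
  have fR: "R x (f x)" if "x \<in> C" for x
    using that unfolding C_def f_def by (auto intro: someI_ex)
  have small: "\<exists>n. 2 * (1/2)^n < r" if "r > 0" for r :: real
    using real_arch_pow_inv[of "r/2" "1/2"] that by (auto simp: field_simps)
  \<comment> \<open>Both points lie within \<open>(1/2)^n\<close> of the same point
    \<open>e (x n)\<close>; agreement on \<open>Suc n\<close> entries is what includes the index
    \<open>n\<close>.\<close>
  have close: "d a b \<le> 2 * (1/2)^n" if "R x a" "R y b" "agree (Suc n) x y" for x y a b n
  proof -
    have "x n = y n" using that(3) by (simp add: agree_def)
    moreover have "a \<in> M" "b \<in> M" using that KM by (auto simp: R_def)
    then have "d a b \<le> d (e (x n)) a + d (e (x n)) b"
      by (metis triangle commute eM)
    moreover have "d (e (x n)) a \<le> (1/2)^n" "d (e (y n)) b \<le> (1/2)^n"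
      using that by (auto simp: R_def)
    ultimately show ?thesis by simp
  qed
  have uniq: "f x = a" if "R x a" for x a
  proof (rule ccontr)
    assume ne: "f x \<noteq> a"
    have "R x (f x)" using fR that C_def by blast
    moreover from this that have "f x \<in> M" "a \<in> M" using KM by (auto simp: R_def)
    then have "d (f x) a > 0" using ne by simp
    then obtain n where "2 * (1/2)^n < d (f x) a" using small by blast
    ultimately show False using close[of x "f x" x a n] that by simp
  qed
  have "seq_closed C"
    unfolding seq_closed_def
  proof (intro allI impI)
    fix x :: "nat \<Rightarrow> nat" assume "\<forall>n. \<exists>y\<in>C. agree n x y"
    then have "\<exists>y a. agree n x y \<and> R y a" for n unfolding C_def by blast
    \<comment> \<open>The codes \<open>y n\<close> agree with \<open>x\<close> on ever longer
      segments, so by \<open>close\<close> the points \<open>a n\<close> form a Cauchy sequence. Its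
      limit turns out to be coded by \<open>x\<close>.\<close>
    then obtain y a where y: "\<And>n. agree n x (y n)" and a: "\<And>n. R (y n) (a n)" by metis
    have aK: "a n \<in> K" for n using a by (simp add: R_def)
    have "MCauchy a"
      unfolding MCauchy_def
    proof (intro conjI allI impI)
      show "range a \<subseteq> M" using aK KM by blast
      fix r :: real assume "r > 0"
      then obtain N where N: "2 * (1/2)^N < r" using small by blast
      have "d (a n) (a n') < r" if "Suc N \<le> n" "Suc N \<le> n'" for n n'
      proof -
        have "agree (Suc N) (y n) (y n')"
          using y[of n] y[of n'] that by (metis agree_mono agree_sym agree_trans)
        then show ?thesis using close[OF a a] N by fastforce
      qed
      then show "\<exists>N. \<forall>n n'. N \<le> n \<longrightarrow> N \<le> n' \<longrightarrow> d (a n) (a n') < r" by blast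
    qed
    then obtain l where l: "limitin mtopology a l sequentially"
      using compl unfolding mcomplete_def by blast
    have "l \<in> K"
      by (rule limitin_closedin[OF l]) (use K \<O>_def aK in auto)
    moreover have "d (e (x i)) l \<le> (1/2)^i" for i
    proof -
      \<comment> \<open>Beyond stage \<open>i\<close> the code of \<open>a n\<close> has the same
        entry at \<open>i\<close> as \<open>x\<close>, and a closed ball contains the limit of a
        sequence that is eventually in it.\<close>
      have "a n \<in> mcball (e (x i)) ((1/2)^i)" if "i < n" for n
        using y[of n] a[of n] that KM by (auto simp: agree_def R_def)
      then have "eventually (\<lambda>n. a n \<in> mcball (e (x i)) ((1/2)^i)) sequentially"
        using eventually_gt_at_top[of i] by (rule eventually_mono[rotated]) auto
      then have "l \<in> mcball (e (x i)) ((1/2)^i)"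
        by (intro limitin_closedin[OF l]) auto
      then show ?thesis by simp
    qed
    ultimately show "x \<in> C" by (auto simp: C_def R_def)
  qed
  moreover have "seq_continuous \<O> C f"
    unfolding seq_continuous_def
  proof (intro ballI allI impI)
    fix x U assume x: "x \<in> C" and U: "openin \<O> U" "f x \<in> U"
    then obtain r where r: "r > 0" "mball (f x) r \<subseteq> U"
      unfolding \<O>_def openin_mtopology by blast
    obtain n where n: "2 * (1/2)^n < r" using small r(1) by blast
    have "f y \<in> U" if "y \<in> C" "agree (Suc n) x y" for y
    proof -
      have "d (f x) (f y) < r" using close[OF fR fR] x that n by fastforce
      moreover have "f x \<in> M" "f y \<in> M" using fR x that KM by (auto simp: R_def)
      ultimately show ?thesis using r(2) by auto
    qed
    then show "\<exists>n. \<forall>y\<in>C. agree n x y \<longrightarrow> f y \<in> U" by blast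
  qed
  moreover have "f ` C = K"
  proof
    show "f ` C \<subseteq> K" using fR by (auto simp: R_def)
    show "K \<subseteq> f ` C"
    proof
      fix a assume a: "a \<in> K"
      have "\<exists>j. d (e j) a \<le> (1/2)^i" for i
      proof -
        obtain q where "q \<in> Q" "d a q < (1/2)^i"
          using dense[of a "(1/2)^i"] a KM by auto
        then show ?thesis using e commute by (metis imageE less_imp_le)
      qed
      then obtain x where "\<And>i. d (e (x i)) a \<le> (1/2)^i" by metis
      then have "R x a" using a by (simp add: R_def)
      then show "a \<in> f ` C" using uniq C_def by blast
    qed
  qed
  ultimately show ?thesis
    using closedin_subset[OF K] unfolding analytic_in_def by blast
qed

section \<open>Open and Borel sets are analytic\<close>

lemma analytic_in_openin:
  assumes \<O>: "completely_metrizable_space \<O>" "separable_space \<O>" and U: "openin \<O> U"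
  shows "analytic_in \<O> U"
proof -
  have "fsigma_in \<O> U"
    using assms completely_metrizable_imp_metrizable_space open_imp_fsigma_in by blast
  then obtain C :: "nat \<Rightarrow> 'a set" where "\<And>n. closedin \<O> (C n)" "\<Union>(range C) = U"
    unfolding fsigma_in_ascending by blast
  then show ?thesis
    using analytic_in_Union[of \<O> C] analytic_in_closedin[OF \<O>] by auto
qed

text \<open>Complements of analytic sets need not be analytic, so the induction carries the
  complement along; for a countable union the complement is a countable intersection.\<close>

lemma analytic_in_Borel:
  assumes \<O>: "completely_metrizable_space \<O>" "separable_space \<O>"
    and A: "A \<in> sigma_sets (topspace \<O>) {U. openin \<O> U}"
  shows "analytic_in \<O> A"
proof -
  have haus: "Hausdorff_space \<O>"
    using \<O>(1) by (simp add: completely_metrizable_imp_metrizable_space metrizable_imp_Hausdorff_space)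
  have "analytic_in \<O> A \<and> analytic_in \<O> (topspace \<O> - A)"
    using A
  proof (induction rule: sigma_sets.induct)
    case (Basic U)
    then have "closedin \<O> (topspace \<O> - U)" by blast
    then show ?case using Basic analytic_in_openin[OF \<O>] analytic_in_closedin[OF \<O>] by blast
  next
    case Empty
    then show ?case using analytic_in_openin[OF \<O>] by auto
  next
    case (Compl A)
    then have "topspace \<O> - (topspace \<O> - A) = A"
      by (auto simp: analytic_in_def)
    then show ?case using Compl by simp
  next
    case (Union A)
    have "topspace \<O> - \<Union>(range A) = (\<Inter>n. topspace \<O> - A n)" by blast
    then show ?case
      using Union analytic_in_Union[of \<O> A] analytic_in_Inter[OF haus, of "\<lambda>n. topspace \<O> - A n"]
      by simp
  qed
  then show ?thesis ..
qed

subsection \<open>The perfect set theorem\<close>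

definition cyl :: "(nat \<Rightarrow> 'b) set \<Rightarrow> nat \<Rightarrow> (nat \<Rightarrow> 'b) \<Rightarrow> (nat \<Rightarrow> 'b) set" where
  "cyl C n x = {y \<in> C. agree n x y}"

text \<open>A cylinder is determined by the finite list of its prescribed entries, and lists over a
  countable type are countable.\<close>

lemma countable_cyls: "countable {cyl C n x | n (x :: nat \<Rightarrow> 'b :: countable). True}"
proof (rule countable_subset)
  show "{cyl C n x | n x. True} \<subseteq> range (\<lambda>l. {y \<in> C. \<forall>i<length l. l ! i = y i})"
  proof safe
    fix n and x :: "nat \<Rightarrow> 'b"
    have "cyl C n x = {y \<in> C. \<forall>i<length (map x [0..<n]). map x [0..<n] ! i = y i}"
      by (auto simp: cyl_def agree_def)
    then show "cyl C n x \<in> range (\<lambda>l. {y \<in> C. \<forall>i<length l. l ! i = y i})" by blast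
  qed
qed simp

text \<open>
  The points all of whose neighbourhoods have uncountable image leave out only countably much of
  the image. So every neighbourhood of such a point contains two such points with distinct images,
  and these have neighbourhoods with disjoint images.
\<close>

lemma condensation_split:
  fixes C :: "(nat \<Rightarrow> 'b :: countable) set"
  assumes \<O>: "Hausdorff_space \<O>" and f: "seq_continuous \<O> C f" and fC: "f ` C \<subseteq> topspace \<O>"
  defines "K \<equiv> {x \<in> C. \<forall>n. uncountable (f ` cyl C n x)}"
  shows "uncountable (f ` C) \<Longrightarrow> K \<noteq> {}"
    and "x \<in> K \<Longrightarrow> \<exists>y z m. y \<in> K \<and> z \<in> K \<and> n < m \<and> agree n x y \<and> agree n x z \<and>
           f ` cyl C m y \<inter> f ` cyl C m z = {}"
proof -
  \<comment> \<open>A point outside \<open>K\<close> lies in a cylinder with countable image. There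
    are only countably many cylinders, so these images together are countable.\<close>
  have "f ` (C - K) \<subseteq> (\<Union>Z \<in> {cyl C n x | n x. True} \<inter> {Z. countable (f ` Z)}. f ` Z)"
  proof
    fix a assume "a \<in> f ` (C - K)"
    then obtain x where x: "x \<in> C" "x \<notin> K" "a = f x" by blast
    then obtain n where "countable (f ` cyl C n x)" unfolding K_def by blast
    moreover have "a \<in> f ` cyl C n x" using x by (simp add: cyl_def)
    ultimately show "a \<in> (\<Union>Z \<in> {cyl C n x | n x. True} \<inter> {Z. countable (f ` Z)}. f ` Z)"
      by blast
  qed
  then have cnt: "countable (f ` (C - K))"
    by (rule countable_subset) (intro countable_UN countable_Int1 countable_cyls, simp)
  {
    assume unc: "uncountable (f ` C)"
    show "K \<noteq> {}"
    proof
      assume "K = {}"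
      then show False using cnt unc by simp
    qed
  }
  assume x: "x \<in> K"
  have "uncountable (f ` (cyl C n x \<inter> K))"
  proof
    assume "countable (f ` (cyl C n x \<inter> K))"
    then have "countable (f ` (cyl C n x \<inter> K) \<union> f ` (C - K))" using cnt by simp
    then have "countable (f ` cyl C n x)"
      by (rule countable_subset[rotated]) (auto simp: cyl_def)
    then show False using x by (simp add: K_def)
  qed
  then have inf: "infinite (f ` (cyl C n x \<inter> K))" by (rule uncountable_infinite)
  then have "\<exists>a. a \<in> f ` (cyl C n x \<inter> K)"
    unfolding ex_in_conv by (rule infinite_imp_nonempty)
  then obtain a where a: "a \<in> f ` (cyl C n x \<inter> K)" ..
  have "f ` (cyl C n x \<inter> K) - {a} \<noteq> {}"
    using inf by (intro infinite_imp_nonempty) simp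
  then obtain b where b: "b \<in> f ` (cyl C n x \<inter> K)" "b \<noteq> a" by auto
  obtain y z where y: "y \<in> cyl C n x" "y \<in> K" "a = f y" and z: "z \<in> cyl C n x" "z \<in> K" "b = f z"
    using a b by blast
  have "y \<in> C" "z \<in> C" using y z by (auto simp: K_def)
  then have "f y \<in> topspace \<O>" "f z \<in> topspace \<O>" using fC by blast+
  then obtain U V where U: "openin \<O> U" "f y \<in> U" and V: "openin \<O> V" "f z \<in> V" and UV: "disjnt U V"
    using \<O> b(2) y(3) z(3) unfolding Hausdorff_space_def by metis
  obtain k where k: "\<forall>w\<in>C. agree k y w \<longrightarrow> f w \<in> U"
    using seq_continuousD[of \<O> C f y U] f \<open>y \<in> C\<close> U by auto
  obtain l where l: "\<forall>w\<in>C. agree l z w \<longrightarrow> f w \<in> V"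
    using seq_continuousD[of \<O> C f z V] f \<open>z \<in> C\<close> V by auto
  \<comment> \<open>Long enough for both neighbourhoods; the successor makes \<open>n < m\<close>
    strict, so that lengths grow when the splitting is iterated.\<close>
  define m where "m = Suc (max n (max k l))"
  have m: "n < m" "k \<le> m" "l \<le> m" by (auto simp: m_def)
  have "f ` cyl C m y \<subseteq> U" "f ` cyl C m z \<subseteq> V"
    using k l m by (auto simp: cyl_def dest: agree_mono)
  then have "f ` cyl C m y \<inter> f ` cyl C m z = {}" using UV unfolding disjnt_def by blast
  moreover have "agree n x y" "agree n x z" using y z by (auto simp: cyl_def)
  ultimately show "\<exists>y z m. y \<in> K \<and> z \<in> K \<and> n < m \<and> agree n x y \<and> agree n x z \<and>
           f ` cyl C m y \<inter> f ` cyl C m z = {}"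
    using y(2) z(2) m(1) by blast
qed

text \<open>A Cantor scheme: iterated splitting gives a binary tree of cylinders in which siblings
  have disjoint images. A 0-1 sequence selects a branch, the branch converges to a point of the
  closed set \<open>C\<close>, and \<open>h\<close> takes the image of that point.\<close>

lemma analytic_in_perfect_set:
  assumes \<O>: "Hausdorff_space \<O>" and A: "analytic_in \<O> A" and unc: "uncountable A"
  obtains h :: "(nat \<Rightarrow> bool) \<Rightarrow> 'a"
    where "inj h" "range h \<subseteq> A" "seq_continuous \<O> UNIV h"
proof -
  obtain C :: "(nat \<Rightarrow> nat) set" and f
    where C: "seq_closed C" and f: "seq_continuous \<O> C f" and fC: "f ` C = A"
      and A: "A \<subseteq> topspace \<O>"
    using A unfolding analytic_in_def by blast
  define K where "K = {x \<in> C. \<forall>n. uncountable (f ` cyl C n x)}"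
  note split = condensation_split[OF \<O> f, folded K_def]
  have "K \<noteq> {}" using split(1) fC A unc by simp
  then obtain x0 where x0: "x0 \<in> K" by (meson ex_in_conv)
  \<comment> \<open>Membership in \<open>K\<close> is moved under the existential quantifiers so
    that the choice functions \<open>Y\<close>, \<open>Z\<close>, \<open>m\<close> are total and can
    drive a recursion.\<close>
  have "\<forall>x n. \<exists>y z m. x \<in> K \<longrightarrow> y \<in> K \<and> z \<in> K \<and> n < m \<and> agree n x y \<and> agree n x z \<and>
           f ` cyl C m y \<inter> f ` cyl C m z = {}"
    using split(2)[unfolded fC, OF A] by meson
  then obtain Y Z m where step: "\<And>x n. x \<in> K \<Longrightarrow> Y x n \<in> K \<and> Z x n \<in> K \<and> n < m x n \<and>
      agree n x (Y x n) \<and> agree n x (Z x n) \<and>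
      f ` cyl C (m x n) (Y x n) \<inter> f ` cyl C (m x n) (Z x n) = {}"
    by metis
  \<comment> \<open>The state after \<open>k\<close> bits: the current condensation point and the
    number of its entries that are fixed for good.\<close>
  define S where "S b = rec_nat (x0, 0)
      (\<lambda>k (x, n). (if b k then Y x n else Z x n, m x n))" for b
  define p where "p b k = fst (S b k)" for b k
  define l where "l b k = snd (S b k)" for b k
  have S_Suc: "p b (Suc k) = (if b k then Y (p b k) (l b k) else Z (p b k) (l b k))"
    "l b (Suc k) = m (p b k) (l b k)" for b k
    by (auto simp: p_def l_def S_def split: prod.splits)
  have S_0: "p b 0 = x0" "l b 0 = 0" for b by (auto simp: p_def l_def S_def)
  have pK: "p b k \<in> K" for b k
    by (induction k) (auto simp: S_0 S_Suc x0 step)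
  have l_Suc: "l b k < l b (Suc k)" for b k using step[OF pK] S_Suc by simp
  have l_ge: "k \<le> l b k" for b k
  proof (induction k)
    case (Suc k)
    then show ?case using l_Suc[of b k] by simp
  qed simp
  have l_mono: "l b j \<le> l b k" if "j \<le> k" for b j k
    using that l_Suc by (simp add: lift_Suc_mono_le less_imp_le)
  have ag: "agree (l b k) (p b k) (p b (k + j))" for b k j
  proof (induction j)
    case (Suc j)
    have "agree (l b (k + j)) (p b (k + j)) (p b (Suc (k + j)))"
      using step[OF pK] by (simp add: S_Suc)
    then have "agree (l b k) (p b (k + j)) (p b (Suc (k + j)))"
      using l_mono[of k "k + j" b] agree_mono by auto
    then show ?case using Suc agree_trans by auto
  qed simp
  \<comment> \<open>The limit of the branch. Entry \<open>i\<close> can be read off at stage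
    \<open>Suc i\<close>, since at least \<open>Suc i\<close> entries are fixed by then.\<close>
  define g where "g b i = p b (Suc i) i" for b i
  have g: "agree (l b k) (p b k) (g b)" for b k
    unfolding agree_def
  proof (intro allI impI)
    fix i assume i: "i < l b k"
    show "p b k i = g b i"
    proof (cases "k \<le> Suc i")
      case True
      then show ?thesis using ag[of b k "Suc i - k"] i by (simp add: agree_def g_def)
    next
      case False
      then show ?thesis using ag[of b "Suc i" "k - Suc i"] l_ge[of "Suc i" b]
        by (simp add: agree_def g_def)
    qed
  qed
  have gC: "g b \<in> C" for b
  proof (rule seq_closedD[OF C])
    fix n
    have "agree n (g b) (p b n)" using g[of b n] l_ge[of n b] agree_mono agree_sym by metis
    moreover have "p b n \<in> C" using pK by (simp add: K_def)
    ultimately show "\<exists>y\<in>C. agree n (g b) y" by blast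
  qed
  have g_cyl: "g b \<in> cyl C (l b k) (p b k)" for b k
    using gC g by (simp add: cyl_def)
  \<comment> \<open>Stage \<open>k\<close> looks only at the first \<open>k\<close> bits.\<close>
  have S_cong: "S b k = S b' k" if "agree k b b'" for b b' k
    using that
  proof (induction k)
    case (Suc k)
    then have "S b k = S b' k" "b k = b' k" by (auto simp: agree_def)
    then show ?case by (simp add: S_def)
  qed (simp add: S_def)
  define h where "h b = f (g b)" for b
  show thesis
  proof (rule that[of h])
    show "range h \<subseteq> A" using gC fC by (auto simp: h_def)
    show "inj h"
    proof (rule injI, rule ccontr)
      fix b b' assume eq: "h b = h b'" and ne: "b \<noteq> b'"
      \<comment> \<open>Up to the first differing bit both branches are in the same state; the next
        step sends them to siblings with disjoint images.\<close>
      define k where "k = (LEAST k. b k \<noteq> b' k)"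
      have k: "b k \<noteq> b' k" unfolding k_def by (rule LeastI_ex) (use ne in auto)
      have "agree k b b'" unfolding agree_def k_def using not_less_Least by blast
      then have "p b k = p b' k" "l b k = l b' k" using S_cong by (auto simp: p_def l_def)
      then have "f ` cyl C (l b (Suc k)) (p b (Suc k)) \<inter> f ` cyl C (l b' (Suc k)) (p b' (Suc k)) = {}"
        using step[OF pK[of b' k], of "l b' k"] k by (auto simp: S_Suc)
      then show False using g_cyl[of b "Suc k"] g_cyl[of b' "Suc k"] eq unfolding h_def by blast
    qed
    show "seq_continuous \<O> UNIV h"
      unfolding seq_continuous_def
    proof (intro ballI allI impI)
      fix b U assume U: "openin \<O> U" "h b \<in> U"
      obtain n where n: "\<forall>y\<in>C. agree n (g b) y \<longrightarrow> f y \<in> U"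
        using seq_continuousD[of \<O> C f "g b" U] f gC[of b] U by (auto simp: h_def)
      have "h b' \<in> U" if b': "agree n b b'" for b'
      proof -
        \<comment> \<open>Entry \<open>i\<close> of the limit depends on \<open>Suc i\<close> bits,
          so \<open>n\<close> common bits give \<open>n\<close> common entries.\<close>
        have "S b (Suc i) = S b' (Suc i)" if "i < n" for i
          using that b' by (intro S_cong agree_mono[OF b']) simp
        then have "agree n (g b) (g b')"
          by (simp add: agree_def g_def p_def)
        then show ?thesis using n gC by (simp add: h_def)
      qed
      then show "\<exists>n. \<forall>b'\<in>UNIV. agree n b b' \<longrightarrow> h b' \<in> U" by blast
    qed
  qed
qed

subsection \<open>Continuous measures\<close>

definition coin_space :: "(nat \<Rightarrow> bool) measure" where
  "coin_space = PiM UNIV (\<lambda>_. measure_pmf (bernoulli_pmf (1/2)))"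

lemma prob_space_coin_space: "prob_space coin_space"
  unfolding coin_space_def by (intro prob_space_PiM prob_space_measure_pmf)

lemma space_coin_space [simp]: "space coin_space = UNIV"
  by (simp add: coin_space_def space_PiM)

lemma sets_agree [measurable]: "{y. agree n x y} \<in> sets coin_space"
proof -
  have "Measurable.pred coin_space (\<lambda>y. \<forall>i<n. x i = y i)"
    unfolding coin_space_def by measurable
  then show ?thesis by (simp add: agree_def pred_def)
qed

lemma measure_agree: "measure coin_space {y. agree n x y} = (1/2)^n"
proof -
  let ?M = "\<lambda>_ :: nat. measure_pmf (bernoulli_pmf (1/2))"
  \<comment> \<open>A product of singletons in the first \<open>n\<close> coordinates, each of mass
    one half.\<close>
  have "{y. agree n x y} = prod_emb UNIV ?M {..<n} (\<Pi>\<^sub>E i\<in>{..<n}. {x i})"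
    by (rule set_eqI) (simp add: agree_def prod_emb_iff Pi_iff Ball_def eq_commute[of "x _"])
  then have "emeasure coin_space {y. agree n x y} = (\<Prod>i<n. emeasure (?M i) {x i})"
    unfolding coin_space_def by (simp add: emeasure_PiM_emb prob_space_measure_pmf)
  also have "\<dots> = (\<Prod>i<n. ennreal (1/2))"
  proof (rule prod.cong)
    fix i show "emeasure (?M i) {x i} = ennreal (1/2)"
      by (cases "x i") (simp_all add: emeasure_pmf_single)
  qed simp
  also have "\<dots> = ennreal ((1/2)^n)" by (simp only: prod_constant card_lessThan ennreal_power)
  finally show ?thesis by (simp add: measure_def)
qed

text \<open>A point lies in a cylinder of measure \<open>(1/2)^n\<close> for every
  \<open>n\<close>.\<close>

lemma measure_coin_space_singleton: "measure coin_space {x} = 0"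
proof -
  interpret prob_space coin_space by (rule prob_space_coin_space)
  have *: "measure coin_space {x} \<le> (1/2)^n" for n
  proof -
    have "measure coin_space {x} \<le> measure coin_space {y. agree n x y}"
      by (rule finite_measure_mono) auto
    also have "\<dots> = (1/2)^n"
      by (rule measure_agree)
    finally show ?thesis .
  qed
  have "measure coin_space {x} \<le> 0"
    by (rule LIMSEQ_le_const[OF LIMSEQ_power_zero[of "1/2 :: real"]]) (use * in auto)
  then show ?thesis by (simp add: measure_le_0_iff)
qed

text \<open>The preimage of an open set is the union of the cylinders inside it, and there are only
  countably many cylinders.\<close>

lemma seq_continuous_measurable:
  assumes X: "sets X = sigma_sets (space X) {U. openin \<O> U}" "topspace \<O> = space X"
    and h: "seq_continuous \<O> UNIV h" "range h \<subseteq> space X"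
  shows "h \<in> measurable coin_space X"
proof (rule measurable_sigma_sets[OF X(1)])
  show "{U. openin \<O> U} \<subseteq> Pow (space X)" using openin_subset X(2) by blast
  show "h \<in> space coin_space \<rightarrow> space X" using h(2) by auto
  fix U assume U: "U \<in> {U. openin \<O> U}"
  let ?Z = "{cyl UNIV n x | n x. True} \<inter> Pow (h -` U)"
  have "h -` U \<subseteq> \<Union>?Z"
  proof
    fix x assume x: "x \<in> h -` U"
    then obtain n where "\<forall>y\<in>UNIV. agree n x y \<longrightarrow> h y \<in> U"
      using seq_continuousD[OF h(1), of x U] U by auto
    then have "cyl UNIV n x \<in> ?Z" by (auto simp: cyl_def)
    moreover have "x \<in> cyl UNIV n x" by (simp add: cyl_def)
    ultimately show "x \<in> \<Union>?Z" by blast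
  qed
  then have "h -` U \<inter> space coin_space = \<Union>?Z" by auto
  also have "\<dots> \<in> sets coin_space"
  proof (rule sets.countable_Union)
    show "countable ?Z" by (intro countable_Int1 countable_cyls)
    show "?Z \<subseteq> sets coin_space" using sets_agree by (auto simp: cyl_def)
  qed
  finally show "h -` U \<inter> space coin_space \<in> sets coin_space" .
qed

lemma standard_borel_singleton:
  assumes "standard_borel X" "x \<in> space X"
  shows "{x} \<in> sets X"
proof -
  obtain \<O> where \<O>: "completely_metrizable_space \<O>"
    and top: "topspace \<O> = space X" and sets: "sets X = sigma_sets (space X) {U. openin \<O> U}"
    using assms(1) unfolding standard_borel_def by blast
  have "Hausdorff_space \<O>"
    using \<O> by (simp add: completely_metrizable_imp_metrizable_space metrizable_imp_Hausdorff_space)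
  then have "closedin \<O> {x}" using assms(2) top by (simp add: closedin_Hausdorff_singleton)
  then have "openin \<O> (space X - {x})" unfolding closedin_def top by simp
  then have "space X - (space X - {x}) \<in> sets X"
    unfolding sets by (intro sigma_sets.Compl sigma_sets.Basic) simp
  then show ?thesis using assms(2) by (simp add: Diff_Diff_Int)
qed

text \<open>The coin-tossing measure is pushed forward along an injection into \<open>F\<close>: all
  mass lands in \<open>F\<close>, and a point has at most one preimage, which is null.\<close>

lemma continuous_measure_exists:
  fixes X :: "'a measure"
  assumes X: "standard_borel X" and F: "F \<in> sets X" "uncountable F"
  obtains \<mu> where "\<mu> \<in> cont_prob_measures X" "measure \<mu> F = 1"
proof -
  obtain \<O> where \<O>: "completely_metrizable_space \<O>" "separable_space \<O>"
    and top: "topspace \<O> = space X" and sets: "sets X = sigma_sets (space X) {U. openin \<O> U}"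
    using X unfolding standard_borel_def by blast
  have haus: "Hausdorff_space \<O>"
    using \<O>(1) by (simp add: completely_metrizable_imp_metrizable_space metrizable_imp_Hausdorff_space)
  have an: "analytic_in \<O> F" using analytic_in_Borel[OF \<O>] F(1) sets top by simp
  obtain h :: "(nat \<Rightarrow> bool) \<Rightarrow> 'a"
    where h: "inj h" "range h \<subseteq> F" "seq_continuous \<O> UNIV h"
    by (rule analytic_in_perfect_set[OF haus an F(2)])
  have FX: "F \<subseteq> space X" using F(1) by (rule sets.sets_into_space)
  have meas: "h \<in> measurable coin_space X"
    using seq_continuous_measurable[OF sets top h(3)] h(2) FX by blast
  interpret prob_space coin_space by (rule prob_space_coin_space)
  show thesis
  proof (rule that[of "distr coin_space X h"])
    have "measure (distr coin_space X h) {x} = 0" if "x \<in> space X" for x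
    proof -
      have "measure (distr coin_space X h) {x} = measure coin_space (h -` {x})"
        using meas standard_borel_singleton[OF X that] by (simp add: measure_distr)
      also have "\<dots> = 0"
      proof (cases "x \<in> range h")
        case True
        then obtain b where "h -` {x} = {b}" using h(1) by (auto simp: inj_def)
        then show ?thesis by (simp add: measure_coin_space_singleton)
      next
        case False
        then have "h -` {x} = {}" by auto
        then show ?thesis by simp
      qed
      finally show ?thesis .
    qed
    then show "distr coin_space X h \<in> cont_prob_measures X"
      using prob_space_distr[OF meas] by (simp add: cont_prob_measures_def prob_measures_def)
    have "h -` F = UNIV" using h(2) by auto
    then show "measure (distr coin_space X h) F = 1"
      using meas F(1) prob_space by (simp add: measure_distr)
  qed
qed

subsection \<open>Automorphisms moving an uncountable set\<close>

lemma Aut_in_space_iff: "T \<in> Aut X \<Longrightarrow> T x \<in> space X \<longleftrightarrow> x \<in> space X"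
  by (simp add: Aut_def permutes_in_image)

lemma Aut_inverses:
  assumes "T \<in> Aut X"
  shows "T (inv T x) = x" "inv T (T x) = x"
  using assms by (auto simp: Aut_def permutes_inverses)

text \<open>Turns images into preimages under the measurable inverse, which makes them Borel and
  lets indicators be transported.\<close>

lemma Aut_image_eq:
  assumes T: "T \<in> Aut X" and F: "F \<in> sets X"
  shows "T ` F = inv T -` F \<inter> space X"
proof -
  have "F \<subseteq> space X" using F by (rule sets.sets_into_space)
  then have "T ` F \<subseteq> inv T -` F \<inter> space X"
    using Aut_in_space_iff[OF T] by (auto simp: Aut_inverses[OF T])
  moreover have "x \<in> T ` F" if "inv T x \<in> F" for x
    using imageI[OF that, of T] by (simp add: Aut_inverses[OF T])
  ultimately show ?thesis by blast
qed

lemma Aut_image_sets: "T \<in> Aut X \<Longrightarrow> F \<in> sets X \<Longrightarrow> T ` F \<in> sets X"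
  by (auto simp: Aut_image_eq Aut_def intro: measurable_sets)

section \<open>Borel sets that separate points\<close>

text \<open>Balls with radii \<open>1/(n+1)\<close> about the points of a countable dense set: if
  the radius is below half of \<open>d x y\<close>, a ball containing \<open>x\<close> cannot
  contain \<open>y\<close>.\<close>

lemma standard_borel_separating:
  assumes "standard_borel X"
  obtains A :: "nat \<Rightarrow> 'a set"
    where "range A \<subseteq> sets X"
      and "\<And>x y. x \<in> space X \<Longrightarrow> y \<in> space X \<Longrightarrow> x \<noteq> y \<Longrightarrow> \<exists>n. x \<in> A n \<and> y \<notin> A n"
proof -
  obtain \<O> where \<O>: "completely_metrizable_space \<O>" "separable_space \<O>"
    and top: "topspace \<O> = space X" and sets: "sets X = sigma_sets (space X) {U. openin \<O> U}"
    using assms unfolding standard_borel_def by blast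
  obtain M d where "Metric_space M d" and \<O>_def: "\<O> = Metric_space.mtopology M d"
    using \<O>(1) unfolding completely_metrizable_space_def by blast
  then interpret Metric_space M d by simp
  have MX: "M = space X" using top by (simp add: \<O>_def)
  obtain Q where Q: "countable Q" "Q \<subseteq> M" "mtopology closure_of Q = M"
    using \<O>(2) unfolding separable_space_def \<O>_def by auto
  \<comment> \<open>The empty set is adjoined so that the family can be enumerated even if
    \<open>Q\<close> is empty.\<close>
  let ?\<A> = "insert {} ((\<lambda>(q, n). mball q (inverse (real (Suc n)))) ` (Q \<times> UNIV))"
  have "countable ?\<A>" using Q(1) by auto
  then have "range (from_nat_into ?\<A>) = ?\<A>" by (intro range_from_nat_into) auto
  then obtain A :: "nat \<Rightarrow> 'a set" where ran: "range A = ?\<A>" by (rule that)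
  show thesis
  proof (rule that[of A])
    show "range A \<subseteq> sets X"
      unfolding ran using sets by (auto simp: \<O>_def intro!: sigma_sets.Basic)
    fix x y assume xy: "x \<in> space X" "y \<in> space X" "x \<noteq> y"
    then have "d x y / 2 > 0" using MX by simp
    then obtain n where n: "inverse (real (Suc n)) < d x y / 2" using reals_Archimedean by blast
    have "x \<in> mtopology closure_of Q" using xy(1) Q(3) MX by simp
    moreover have "0 < inverse (real (Suc n))" by simp
    ultimately obtain q where q: "q \<in> Q" "d x q < inverse (real (Suc n))"
      unfolding metric_closure_of mball_def by blast
    have qM: "q \<in> M" using q Q by blast
    have "d x y \<le> d x q + d q y" using qM xy MX triangle by blast
    then have "\<not> d q y < inverse (real (Suc n))" using q n by linarith
    moreover have "d q x < inverse (real (Suc n))" using q commute by metis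
    ultimately have "x \<in> mball q (inverse (real (Suc n)))" "y \<notin> mball q (inverse (real (Suc n)))"
      using qM xy(1,2) unfolding MX[symmetric] by (auto simp del: of_nat_Suc)
    moreover have "mball q (inverse (real (Suc n))) \<in> ?\<A>"
      using q(1) by (intro insertI2 image_eqI[of _ _ "(q, n)"]) auto
    ultimately have "\<exists>B\<in>?\<A>. x \<in> B \<and> y \<notin> B" by blast
    then show "\<exists>n. x \<in> A n \<and> y \<notin> A n"
      unfolding ran[symmetric] by simp
  qed
qed

text \<open>Serves twice: it shows that the disagreement set of two measurable maps is Borel, and it
  cuts the set of moved points into countably many pieces.\<close>

lemma disagreement_eq_UN:
  assumes "\<And>x y. x \<in> space X \<Longrightarrow> y \<in> space X \<Longrightarrow> x \<noteq> y \<Longrightarrow> \<exists>n::nat. x \<in> A n \<and> y \<notin> A n"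
    and "f \<in> measurable X X" "g \<in> measurable X X"
  shows "{x \<in> space X. f x \<noteq> g x} = (\<Union>n. (f -` A n \<inter> space X) - (g -` A n \<inter> space X))"
proof -
  have "f x \<in> space X" "g x \<in> space X" if "x \<in> space X" for x
    using assms(2,3) that by (auto intro: measurable_space)
  then have "\<exists>n. f x \<in> A n \<and> g x \<notin> A n" if "x \<in> space X" "f x \<noteq> g x" for x
    using assms(1) that by simp
  then show ?thesis by auto
qed

lemma sets_disagreement:
  assumes "standard_borel X" and fg: "f \<in> measurable X X" "g \<in> measurable X X"
  shows "{x \<in> space X. f x \<noteq> g x} \<in> sets X"
proof -
  obtain A :: "nat \<Rightarrow> 'a set" where A: "range A \<subseteq> sets X"
    and sep: "\<And>x y. x \<in> space X \<Longrightarrow> y \<in> space X \<Longrightarrow> x \<noteq> y \<Longrightarrow> \<exists>n. x \<in> A n \<and> y \<notin> A n"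
    using standard_borel_separating[OF assms(1)] by metis
  have "A n \<in> sets X" for n using A by blast
  then show ?thesis
    using fg by (subst disagreement_eq_UN[where A=A, OF sep])
      (auto intro!: sets.countable_UN sets.Diff measurable_sets)
qed

lemma diff_set_sets:
  assumes "standard_borel X" "S \<in> Aut X" "T \<in> Aut X"
  shows "diff_set X S T \<in> sets X"
  using assms unfolding diff_set_def Aut_def by (intro sets.Un sets_disagreement) auto

lemma not_Ctbl_moves_set:
  assumes X: "standard_borel X" and T: "T \<in> Aut X" "T \<notin> Ctbl X"
  obtains F where "F \<in> sets X" "uncountable F" "T ` F \<inter> F = {}"
proof -
  obtain A :: "nat \<Rightarrow> 'a set" where A: "range A \<subseteq> sets X"
    and sep: "\<And>x y. x \<in> space X \<Longrightarrow> y \<in> space X \<Longrightarrow> x \<noteq> y \<Longrightarrow> \<exists>n. x \<in> A n \<and> y \<notin> A n"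
    using standard_borel_separating[OF X] by metis
  have meas: "T \<in> measurable X X" using T by (simp add: Aut_def)
  let ?F = "\<lambda>n. ((\<lambda>x. x) -` A n \<inter> space X) - (T -` A n \<inter> space X)"
  have "uncountable {x \<in> space X. x \<noteq> T x}"
    using T unfolding Ctbl_def by (simp add: eq_commute)
  then have "uncountable (\<Union>n. ?F n)"
    unfolding disagreement_eq_UN[OF sep measurable_ident meas, simplified] by simp
  then obtain n where n: "uncountable (?F n)" by blast
  have "A n \<in> sets X" using A by blast
  then have "?F n \<in> sets X" using meas by (auto intro!: measurable_sets)
  then show thesis using n by (rule that) auto
qed

section \<open>Bounded Borel functions and basic neighbourhoods\<close>

lemma bounded_borel_unit_le:
  assumes "f \<in> bounded_borel_unit X" "x \<in> space X"
  shows "\<bar>f x\<bar> \<le> 1"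
proof -
  obtain c where "\<forall>y\<in>f ` space X. norm y \<le> c"
    using assms(1) unfolding bounded_borel_unit_def bounded_borel_def bounded_iff by blast
  \<comment> \<open>Boundedness comes first: without it the real supremum would say nothing about
    the values.\<close>
  then have "bdd_above ((\<lambda>x. \<bar>f x\<bar>) ` space X)" by (intro bdd_aboveI2[where M=c]) simp
  then have "\<bar>f x\<bar> \<le> sup_norm X f" unfolding sup_norm_def using assms(2) by (intro cSUP_upper)
  then show ?thesis using assms(1) by (simp add: bounded_borel_unit_def)
qed

lemma indicator_bounded_borel: "F \<in> sets X \<Longrightarrow> indicator F \<in> bounded_borel X"
  by (auto simp: bounded_borel_def bounded_iff intro!: exI[of _ 1] split: split_indicator)

lemma indicator_bounded_borel_unit:
  assumes "F \<in> sets X" "space X \<noteq> {}"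
  shows "indicator F \<in> bounded_borel_unit X"
  using assms indicator_bounded_borel
  by (auto simp: bounded_borel_unit_def sup_norm_def intro!: cSUP_least split: split_indicator)

text \<open>All distances vanish at \<open>T\<close> itself. The suprema of the constant 0 evaluate
  to 0 over nonempty index sets, hence the assumption on the space.\<close>

lemma nbhd_self:
  assumes "T \<in> Aut X" "space X \<noteq> {}" "0 < \<epsilon>"
  shows "T \<in> nbhd_tau X T \<M> \<epsilon>" "T \<in> nbhd_tau' X T \<M> \<epsilon>" "T \<in> nbhd_tau'' X T \<M> \<epsilon>"
    and "T \<in> nbhd_p X T \<F>" "T \<in> nbhd_p_tilde X T \<B> \<epsilon>" "T \<in> nbhd_p_bar X T \<F> \<M> \<epsilon>"
proof -
  have "sets X \<noteq> {}" by auto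
  moreover have "bounded_borel_unit X \<noteq> {}"
    using indicator_bounded_borel_unit[OF sets.empty_sets assms(2)] by blast
  ultimately show "T \<in> nbhd_tau X T \<M> \<epsilon>" "T \<in> nbhd_tau' X T \<M> \<epsilon>" "T \<in> nbhd_tau'' X T \<M> \<epsilon>"
    "T \<in> nbhd_p X T \<F>" "T \<in> nbhd_p_tilde X T \<B> \<epsilon>" "T \<in> nbhd_p_bar X T \<F> \<M> \<epsilon>"
    using assms
    by (simp_all add: nbhd_tau_def nbhd_tau'_def nbhd_tau''_def nbhd_p_def nbhd_p_tilde_def
        nbhd_p_bar_def diff_set_def sup_norm_def)
qed

text \<open>Shows that the whole group is among the generators, which identifies the underlying set
  of each topology.\<close>

lemma nbhd_empty_family:
  "nbhd_tau X T {} \<epsilon> = Aut X" "nbhd_tau' X T {} \<epsilon> = Aut X" "nbhd_tau'' X T {} \<epsilon> = Aut X"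
  "nbhd_p X T {} = Aut X" "nbhd_p_tilde X T {} \<epsilon> = Aut X" "nbhd_p_bar X T {} {} \<epsilon> = Aut X"
  by (auto simp: nbhd_tau_def nbhd_tau'_def nbhd_tau''_def nbhd_p_def nbhd_p_tilde_def nbhd_p_bar_def)

section \<open>Neighbourhoods of \<open>T\<close> that miss \<open>Ctbl X\<close>\<close>

locale moved_set =
  fixes X :: "'a measure" and T :: "'a \<Rightarrow> 'a" and F :: "'a set"
  assumes X: "standard_borel X" and T: "T \<in> Aut X" and F: "F \<in> sets X" "uncountable F"
    and TF: "T ` F \<inter> F = {}"
begin

lemma space_nonempty: "space X \<noteq> {}"
  using F sets.sets_into_space by fastforce

text \<open>Radius 1 suffices wherever there is a radius: every member of \<open>Ctbl X\<close> will
  be at distance at least 1 from \<open>T\<close>.\<close>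

lemmas self = nbhd_self[OF T space_nonempty zero_less_one]

lemma F_subset: "F \<subseteq> space X"
  using F(1) by (rule sets.sets_into_space)

text \<open>If the images agreed, \<open>S\<close> would carry \<open>F\<close> off itself and so
  move uncountably many points.\<close>

lemma Ctbl_image_ne:
  assumes S: "S \<in> Ctbl X"
  shows "S ` F \<noteq> T ` F"
proof
  assume "S ` F = T ` F"
  then have "S x \<noteq> x" if "x \<in> F" for x using TF that by (metis IntI empty_iff imageI)
  then have "F \<subseteq> {x \<in> space X. S x \<noteq> x}" using F_subset by blast
  then show False using S F(2) countable_subset unfolding Ctbl_def by blast
qed

context
  fixes \<mu> assumes \<mu>: "\<mu> \<in> cont_prob_measures X" "measure \<mu> F = 1"
begin

interpretation prob_space \<mu>
  using \<mu>(1) by (simp add: cont_prob_measures_def prob_measures_def)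

lemma sets_\<mu>: "sets \<mu> = sets X" and space_\<mu>: "space \<mu> = space X"
  using \<mu>(1) sets_eq_imp_space_eq by (auto simp: cont_prob_measures_def prob_measures_def)

text \<open>The points moved by \<open>S\<close> form a countable set, hence a null set for the
  continuous measure, so \<open>E\<close> contains almost all of \<open>F\<close>.\<close>

lemma measure_Ctbl_fixed:
  assumes S: "S \<in> Ctbl X" and E: "E \<in> sets X" "\<And>x. x \<in> F \<Longrightarrow> S x = x \<Longrightarrow> x \<in> E"
  shows "measure \<mu> E = 1"
proof -
  let ?D = "{x \<in> space X. S x \<noteq> x}"
  have D: "countable ?D" "?D \<in> sets X"
    using S sets_disagreement[OF X, of S "\<lambda>x. x"] by (auto simp: Ctbl_def Aut_def)
  \<comment> \<open>The measure of a countable set is the sum of the masses of its points.\<close>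
  have "emeasure \<mu> ?D = (\<integral>\<^sup>+x. emeasure \<mu> {x} \<partial>count_space ?D)"
    using standard_borel_singleton[OF X] D(1) by (intro emeasure_countable_singleton) (auto simp: sets_\<mu>)
  also have "\<dots> = (\<integral>\<^sup>+x. 0 \<partial>count_space ?D)"
    using \<mu>(1) by (intro nn_integral_cong) (simp add: cont_prob_measures_def emeasure_eq_measure)
  finally have "emeasure \<mu> ?D = 0" by simp
  then have "?D \<in> null_sets \<mu>" using D by (auto simp: sets_\<mu>)
  then have "measure \<mu> (F - ?D) = 1"
    using \<mu>(2) F(1) sets_\<mu> by (simp add: measure_Diff_null_set)
  moreover have "measure \<mu> (F - ?D) \<le> measure \<mu> E"
    using E F_subset sets_\<mu> by (intro finite_measure_mono) auto
  ultimately show ?thesis using prob_le_1[of E] by linarith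
qed

text \<open>\<open>T\<close> moves every point of \<open>F\<close>, so it differs from
  \<open>S\<close> wherever \<open>S\<close> fixes a point of \<open>F\<close>.\<close>

lemma Ctbl_diff_set:
  assumes S: "S \<in> Ctbl X"
  shows "measure \<mu> (diff_set X S T) = 1"
proof (rule measure_Ctbl_fixed[OF S])
  show "diff_set X S T \<in> sets X" using S by (intro diff_set_sets X T) (simp add: Ctbl_def)
  show "x \<in> diff_set X S T" if "x \<in> F" "S x = x" for x
    using TF that F_subset by (auto simp: diff_set_def)
qed

text \<open>A point of \<open>F\<close> fixed by \<open>S\<close> belongs to \<open>S\<close>
  F\<open>but not to\<close>T \<open>F\<close>.\<close>

lemma Ctbl_sym_diff:
  assumes S: "S \<in> Ctbl X"
  shows "measure \<mu> (sym_diff (T ` F) (S ` F)) = 1"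
proof (rule measure_Ctbl_fixed[OF S])
  show "sym_diff (T ` F) (S ` F) \<in> sets X"
    using S T F(1) by (auto simp: Ctbl_def intro!: Aut_image_sets)
  show "x \<in> sym_diff (T ` F) (S ` F)" if "x \<in> F" "S x = x" for x
  proof -
    have "S x \<in> S ` F" using that(1) by (rule imageI)
    moreover have "x \<notin> T ` F" using TF that(1) by blast
    ultimately show ?thesis using that(2) by simp
  qed
qed

lemma Ctbl_image:
  assumes S: "S \<in> Ctbl X"
  shows "measure \<mu> (S ` F) = 1"
proof (rule measure_Ctbl_fixed[OF S])
  show "S ` F \<in> sets X" using S F(1) by (auto simp: Ctbl_def intro!: Aut_image_sets)
  show "x \<in> S ` F" if "x \<in> F" "S x = x" for x using imageI[of x F S] that by simp
qed

lemma image_null: "measure \<mu> (T ` F) = 0"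
proof -
  have "measure \<mu> (T ` F \<union> F) = measure \<mu> (T ` F) + measure \<mu> F"
    using Aut_image_sets[OF T F(1)] F(1) TF by (intro finite_measure_Union) (auto simp: sets_\<mu>)
  then show ?thesis using prob_le_1[of "T ` F \<union> F"] \<mu>(2) measure_nonneg[of \<mu> "T ` F"] by linarith
qed

lemma comp_integral_indicator:
  assumes "S \<in> Aut X"
  shows "comp_integral \<mu> S (indicator F) = measure \<mu> (S ` F)"
proof -
  have "comp_integral \<mu> S (indicator F) = (\<integral>x. indicator (S ` F) x \<partial>\<mu>)"
    unfolding comp_integral_def
    by (rule Bochner_Integration.integral_cong)
      (use assms F(1) in \<open>auto simp: Aut_image_eq space_\<mu> split: split_indicator\<close>)
  also have "\<dots> = measure \<mu> (S ` F)"
    using Aut_image_sets[OF assms F(1)] by (simp add: sets_\<mu>)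
  finally show ?thesis .
qed

text \<open>Needed to bound the family under the supremum in \<open>nbhd_tau''\<close>, so that a
  single test function gives a lower estimate.\<close>

lemma comp_integral_bound:
  assumes "S \<in> Aut X" "f \<in> bounded_borel_unit X"
  shows "\<bar>comp_integral \<mu> S f\<bar> \<le> 1"
proof -
  have "\<bar>comp_integral \<mu> S f\<bar> \<le> (\<integral>x. \<bar>f (inv S x)\<bar> \<partial>\<mu>)"
    unfolding comp_integral_def by (rule integral_abs_bound)
  also have "\<dots> \<le> (\<integral>x. 1 \<partial>\<mu>)"
  proof (rule integral_mono')
    fix x assume "x \<in> space \<mu>"
    then have "inv S x \<in> space X"
      using Aut_in_space_iff[OF Aut_inv[OF assms(1)]] space_\<mu> by simp
    then show "\<bar>f (inv S x)\<bar> \<le> 1" by (rule bounded_borel_unit_le[OF assms(2)])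
  qed auto
  finally show ?thesis by (simp add: prob_space)
qed

lemma nbhd_tau_separates: "T \<in> nbhd_tau X T {\<mu>} 1 \<and> nbhd_tau X T {\<mu>} 1 \<inter> Ctbl X = {}"
  using Ctbl_diff_set by (intro conjI self) (auto simp: nbhd_tau_def)

lemma nbhd_tau'_separates: "T \<in> nbhd_tau' X T {\<mu>} 1 \<and> nbhd_tau' X T {\<mu>} 1 \<inter> Ctbl X = {}"
proof -
  have "1 \<le> (SUP F\<in>sets X. measure \<mu> (sym_diff (T ` F) (S ` F)))" if S: "S \<in> Ctbl X" for S
  proof -
    have "bdd_above ((\<lambda>F. measure \<mu> (sym_diff (T ` F) (S ` F))) ` sets X)"
      by (rule bdd_aboveI2[where M=1]) (rule prob_le_1)
    then have "measure \<mu> (sym_diff (T ` F) (S ` F)) \<le>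
        (SUP F\<in>sets X. measure \<mu> (sym_diff (T ` F) (S ` F)))"
      by (intro cSUP_upper F(1))
    then show ?thesis by (simp only: Ctbl_sym_diff[OF S])
  qed
  then show ?thesis by (intro conjI self) (force simp: nbhd_tau'_def)
qed

lemma nbhd_tau''_separates: "T \<in> nbhd_tau'' X T {\<mu>} 1 \<and> nbhd_tau'' X T {\<mu>} 1 \<inter> Ctbl X = {}"
proof -
  have "1 \<le> (SUP f\<in>bounded_borel_unit X. \<bar>comp_integral \<mu> S f - comp_integral \<mu> T f\<bar>)"
    if S: "S \<in> Ctbl X" for S
  proof -
    have SA: "S \<in> Aut X" using S by (simp add: Ctbl_def)
    have "bdd_above ((\<lambda>f. \<bar>comp_integral \<mu> S f - comp_integral \<mu> T f\<bar>) ` bounded_borel_unit X)"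
    proof (rule bdd_aboveI2[where M=2])
      fix f assume "f \<in> bounded_borel_unit X"
      then show "\<bar>comp_integral \<mu> S f - comp_integral \<mu> T f\<bar> \<le> 2"
        using comp_integral_bound[OF SA] comp_integral_bound[OF T] by fastforce
    qed
    then have "\<bar>comp_integral \<mu> S (indicator F) - comp_integral \<mu> T (indicator F)\<bar> \<le>
        (SUP f\<in>bounded_borel_unit X. \<bar>comp_integral \<mu> S f - comp_integral \<mu> T f\<bar>)"
      by (intro cSUP_upper indicator_bounded_borel_unit[OF F(1) space_nonempty])
    \<comment> \<open>With the indicator of \<open>F\<close> as test function the difference is the
      measure of \<open>S\<close> F\<open>minus that of\<close>T \<open>F\<close>, that is,
      \<open>1 - 0\<close>.\<close>
    then show ?thesis
      by (simp add: comp_integral_indicator SA T Ctbl_image[OF S] image_null)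
  qed
  then show ?thesis by (intro conjI self) (force simp: nbhd_tau''_def)
qed

lemma nbhd_p_bar_separates: "T \<in> nbhd_p_bar X T {F} {\<mu>} 1 \<and> nbhd_p_bar X T {F} {\<mu>} 1 \<inter> Ctbl X = {}"
proof -
  \<comment> \<open>The first summand alone is 1.\<close>
  have "1 \<le> measure \<mu> (sym_diff (S ` F) (T ` F)) + measure \<mu> (sym_diff (inv S ` F) (inv T ` F))"
    if "S \<in> Ctbl X" for S
    using Ctbl_sym_diff[OF that] by (simp add: Un_commute)
  then show ?thesis by (intro conjI self) (force simp: nbhd_p_bar_def)
qed

end

lemma nbhd_p_separates: "T \<in> nbhd_p X T {F} \<and> nbhd_p X T {F} \<inter> Ctbl X = {}"
  using Ctbl_image_ne by (intro conjI self) (auto simp: nbhd_p_def)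

text \<open>Indicator values differ by 0 or 1, so a norm below 1 forces them to be equal. Then
  \<open>S\<close> F = T \<open>F\<close>, which no member of \<open>Ctbl X\<close>
  satisfies.\<close>

lemma nbhd_p_tilde_separates: "T \<in> nbhd_p_tilde X T {indicator F} 1 \<and>
  nbhd_p_tilde X T {indicator F} 1 \<inter> Ctbl X = {}"
proof -
  have im: "S ` F = T ` F"
    if S: "S \<in> Aut X"
      and less: "sup_norm X (\<lambda>x. indicator F (inv T x) - indicator F (inv S x)) < 1" for S
  proof -
    have "bdd_above ((\<lambda>x. \<bar>indicator F (inv T x) - indicator F (inv S x) :: real\<bar>) ` space X)"
      by (rule bdd_aboveI2[where M=1]) (simp split: split_indicator)
    then have "\<bar>indicator F (inv T x) - indicator F (inv S x) :: real\<bar> < 1" if "x \<in> space X" for x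
      using cSUP_upper[OF that] less unfolding sup_norm_def by fastforce
    then have "inv T x \<in> F \<longleftrightarrow> inv S x \<in> F" if "x \<in> space X" for x
      using that by (fastforce split: split_indicator_asm)
    then show ?thesis unfolding Aut_image_eq[OF S F(1)] Aut_image_eq[OF T F(1)] by auto
  qed
  have "\<not> sup_norm X (\<lambda>x. indicator F (inv T x) - indicator F (inv S x)) < 1" if "S \<in> Ctbl X" for S
    using Ctbl_image_ne[OF that] im[of S] that by (auto simp: Ctbl_def)
  then show ?thesis by (intro conjI self) (auto simp: nbhd_p_tilde_def)
qed

end

section \<open>Closedness in the eight topologies\<close>

text \<open>The complement of \<open>Ctbl X\<close> in the group is the union of the generators that
  miss \<open>Ctbl X\<close>. The generator \<open>N\<close> makes \<open>Aut X\<close> the whole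
  space; it enters through an equation so that the facts on empty families can instantiate it. In
  \<open>sep\<close> both \<open>F\<close> and \<open>\<mu>\<close> are at hand, so one statement
  fits every topology.\<close>

lemma closedin_Ctbl_generated:
  assumes X: "standard_borel X"
    and Aut: "N = Aut X" "N \<in> \<N>" and sub: "\<N> \<subseteq> Pow (Aut X)"
    and sep: "\<And>T F \<mu>. moved_set X T F \<Longrightarrow> \<mu> \<in> cont_prob_measures X \<Longrightarrow> measure \<mu> F = 1 \<Longrightarrow>
      \<exists>N\<in>\<N>. T \<in> N \<and> N \<inter> Ctbl X = {}"
  shows "closedin (topology_generated_by \<N>) (Ctbl X)"
proof -
  have sep': "\<exists>N\<in>\<N>. T \<in> N \<and> N \<inter> Ctbl X = {}" if T: "T \<in> Aut X" "T \<notin> Ctbl X" for T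
  proof -
    obtain F where F: "F \<in> sets X" "uncountable F" "T ` F \<inter> F = {}"
      by (rule not_Ctbl_moves_set[OF X T])
    obtain \<mu> where \<mu>: "\<mu> \<in> cont_prob_measures X" "measure \<mu> F = 1"
      by (rule continuous_measure_exists[OF X F(1,2)])
    have "moved_set X T F" using X T(1) F by (simp add: moved_set_def)
    then show ?thesis using \<mu> by (rule sep)
  qed
  have top: "topspace (topology_generated_by \<N>) = Aut X"
    using sub Aut by auto
  have "openin (topology_generated_by \<N>) (\<Union>{N \<in> \<N>. N \<inter> Ctbl X = {}})"
    by (intro openin_Union) (auto intro: topology_generated_by_Basis)
  moreover have "\<Union>{N \<in> \<N>. N \<inter> Ctbl X = {}} = Aut X - Ctbl X"
    using sub sep' by blast
  moreover have "Ctbl X \<subseteq> Aut X" by (auto simp: Ctbl_def)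
  ultimately show ?thesis
    unfolding closedin_def top by simp
qed

theorem lemma1p6:
  fixes X :: "'a measure"
  assumes "standard_borel X" and "uncountable (space X)"
  shows "closedin (top_tau X) (Ctbl X) \<and>
         closedin (top_tau' X) (Ctbl X) \<and>
         closedin (top_tau'' X) (Ctbl X) \<and>
         closedin (top_p X) (Ctbl X) \<and>
         closedin (top_p_tilde X) (Ctbl X) \<and>
         closedin (top_p_bar X) (Ctbl X) \<and>
         closedin (top_tau_0 X) (Ctbl X) \<and>
         closedin (top_p_0 X) (Ctbl X)"
proof (intro conjI)
  show "closedin (top_tau X) (Ctbl X)"
    unfolding top_tau_def
  \<comment> \<open>What remains, here and below: the group is a generator, as the neighbourhood of
    \<open>id\<close> with an empty family; generators consist of automorphisms; the separating
    neighbourhood is a generator.\<close>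
  proof (rule closedin_Ctbl_generated[OF assms(1) nbhd_empty_family(1)[of X id 1]], goal_cases)
    case 1
    show ?case by (intro CollectI exI conjI, rule refl) (auto simp: Aut_id)
  next
    case 2
    show ?case by (auto simp: nbhd_tau_def)
  next
    case (3 T F \<mu>)
    show ?case
      by (rule bexI, rule moved_set.nbhd_tau_separates[OF 3], intro CollectI exI conjI, rule refl)
        (use 3 in \<open>auto simp: cont_prob_measures_def moved_set_def\<close>)
  qed
next
  show "closedin (top_tau' X) (Ctbl X)"
    unfolding top_tau'_def
  proof (rule closedin_Ctbl_generated[OF assms(1) nbhd_empty_family(2)[of X id 1]], goal_cases)
    case 1
    show ?case by (intro CollectI exI conjI, rule refl) (auto simp: Aut_id)
  next
    case 2
    show ?case by (auto simp: nbhd_tau'_def)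
  next
    case (3 T F \<mu>)
    show ?case
      by (rule bexI, rule moved_set.nbhd_tau'_separates[OF 3], intro CollectI exI conjI, rule refl)
        (use 3 in \<open>auto simp: cont_prob_measures_def moved_set_def\<close>)
  qed
next
  show "closedin (top_tau'' X) (Ctbl X)"
    unfolding top_tau''_def
  proof (rule closedin_Ctbl_generated[OF assms(1) nbhd_empty_family(3)[of X id 1]], goal_cases)
    case 1
    show ?case by (intro CollectI exI conjI, rule refl) (auto simp: Aut_id)
  next
    case 2
    show ?case by (auto simp: nbhd_tau''_def)
  next
    case (3 T F \<mu>)
    show ?case
      by (rule bexI, rule moved_set.nbhd_tau''_separates[OF 3], intro CollectI exI conjI, rule refl)
        (use 3 in \<open>auto simp: cont_prob_measures_def moved_set_def\<close>)
  qed
next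
  show "closedin (top_p X) (Ctbl X)"
    unfolding top_p_def
  proof (rule closedin_Ctbl_generated[OF assms(1) nbhd_empty_family(4)[of X id]], goal_cases)
    case 1
    show ?case by (intro CollectI exI conjI, rule refl) (auto simp: Aut_id)
  next
    case 2
    show ?case by (auto simp: nbhd_p_def)
  next
    case (3 T F \<mu>)
    show ?case
      by (rule bexI, rule moved_set.nbhd_p_separates[OF 3(1)], intro CollectI exI conjI, rule refl)
        (use 3 in \<open>auto simp: moved_set_def\<close>)
  qed
next
  show "closedin (top_p_tilde X) (Ctbl X)"
    unfolding top_p_tilde_def
  proof (rule closedin_Ctbl_generated[OF assms(1) nbhd_empty_family(5)[of X id 1]], goal_cases)
    case 1
    show ?case by (intro CollectI exI conjI, rule refl) (auto simp: Aut_id)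
  next
    case 2
    show ?case by (auto simp: nbhd_p_tilde_def)
  next
    case (3 T F \<mu>)
    show ?case
      by (rule bexI, rule moved_set.nbhd_p_tilde_separates[OF 3(1)], intro CollectI exI conjI, rule refl)
        (use 3 in \<open>auto simp: moved_set_def indicator_bounded_borel\<close>)
  qed
next
  show "closedin (top_p_bar X) (Ctbl X)"
    unfolding top_p_bar_def
  proof (rule closedin_Ctbl_generated[OF assms(1) nbhd_empty_family(6)[of X id 1]], goal_cases)
    case 1
    show ?case by (intro CollectI exI conjI, rule refl) (auto simp: Aut_id)
  next
    case 2
    show ?case by (auto simp: nbhd_p_bar_def)
  next
    case (3 T F \<mu>)
    show ?case
      by (rule bexI, rule moved_set.nbhd_p_bar_separates[OF 3], intro CollectI exI conjI, rule refl)
        (use 3 in \<open>auto simp: cont_prob_measures_def moved_set_def\<close>)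
  qed
next
  show "closedin (top_tau_0 X) (Ctbl X)"
    unfolding top_tau_0_def
  proof (rule closedin_Ctbl_generated[OF assms(1) nbhd_empty_family(1)[of X id 1]], goal_cases)
    case 1
    show ?case by (intro CollectI exI conjI, rule refl) (auto simp: Aut_id)
  next
    case 2
    show ?case by (auto simp: nbhd_tau_def)
  next
    \<comment> \<open>The same neighbourhood as for \<open>top_tau\<close> qualifies, because
      \<open>\<mu>\<close> is continuous.\<close>
    case (3 T F \<mu>)
    show ?case
      by (rule bexI, rule moved_set.nbhd_tau_separates[OF 3], intro CollectI exI conjI, rule refl)
        (use 3 in \<open>auto simp: moved_set_def\<close>)
  qed
next
  show "closedin (top_p_0 X) (Ctbl X)"
    unfolding top_p_0_def
  proof (rule closedin_Ctbl_generated[OF assms(1) nbhd_empty_family(4)[of X id]], goal_cases)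
    case 1
    show ?case by (intro CollectI exI conjI, rule refl) (auto simp: Aut_id)
  next
    case 2
    show ?case by (auto simp: nbhd_p_def)
  next
    \<comment> \<open>The same neighbourhood as for \<open>top_p\<close> qualifies, because
      \<open>F\<close> is uncountable.\<close>
    case (3 T F \<mu>)
    show ?case
      by (rule bexI, rule moved_set.nbhd_p_separates[OF 3(1)], intro CollectI exI conjI, rule refl)
        (use 3 in \<open>auto simp: moved_set_def uncountable_sets_def\<close>)
  qed
qed

end
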